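(* Let $p \in [1,\infty)$. Let $(X, d_X)$ be a geodesic, locally compact, complete, separable metric space, let $Y$ be a locally compact, complete, separable metric space, let $\mu \in \mathcal{M}_+(X)$ be a finite positive Radon measure on $X$, and let $\pi: X \to Y$ be a Borel map. Let $\{\mu_y\}_{y \in Y}$ be a disintegration (defined for every $y\in Y$) of $\mu$ with respect to $\nu := \pi_*\mu$, with $\mu_y \in \mathscr{P}_p(X)$ and $\operatorname{supp}(\mu_y) = \pi^{-1}(y)$ for every $y \in Y$, and let $f: Y \to (\mathscr{P}_p(X), W_p)$, $f(y) = \mu_y$, be the corresponding disintegration map. Then $\mathcal{E}_p(f) = 1$ if and only if the family of fibers $\{\pi^{-1}(y)\}_{y \in Y}$ defines a $p$-metric measure foliation on $X$.
   Context: **Geodesic.** $X$ is geodesic if any two points $x_0,x_1\in X$ are joined by a constant speed minimizing geodesic $\gamma:[0,1]\to X$, i.e. $\gamma(0)=x_0$, $\gamma(1)=x_1$, $d_X(\gamma(s),\gamma(t))=|s-t|\,d_X(x_0,x_1)$ for all $s,t$. **Wasserstein space.** $\mathscr{P}_p(X)$ is the set of Borel probability measures $m$ on $X$ with $\int d_X(x,\tilde x)^p\, dm(x)<\infty$ for some (equivalently any) $\tilde x\in X$, with the distance $W_p(m,m') = \big(\inf_{\gamma} \int d_X(x_1,x_2)^p\, d\gamma(x_1,x_2)\big)^{1/p}$, the infimum being over all probability measures $\gamma$ on $X\times X$ with marginals $m$ and $m'$. **Disintegration.** A disintegration $\{\mu_y\}_{y\in Y}$ of $\mu$ with respect to $\nu=\pi_*\mu$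 (the push-forward of $\mu$ by $\pi$), defined for every $y \in Y$, is a family of measures on $X$ such that: (1) $\mu_y$ is a Borel probability measure on $X$ for every $y\in Y$; (2) $\mu_y$ is concentrated on $\pi^{-1}(y)$ for every $y\in Y$; (3) $y\mapsto \mu_y$ is a Borel map; (4) $\mu(A)=\int_Y \mu_y(A)\,d\nu(y)$ for every Borel set $A\subseteq X$. The disintegration map is $f:Y\to(\mathscr{P}_p(X),W_p)$, $y\mapsto\mu_y$. **Distance between sets.** For nonempty $A,B\subseteq X$, $d(A,B)=\inf\{d_X(a,b): a\in A,\ b\in B\}$, and $d(x,B)=d(\{x\},B)$. For $y',y''\in Y$ set $\rho(y',y''):=d(\pi^{-1}(y'),\pi^{-1}(y''))$ ($\rho$ need not be a metric). **Derivative and energy.** For $y\in Y$, $$|\nabla f(y)|_p := \lim_{\varepsilon\to 0}\ \sup_{\substack{\rho(y,y')\le\varepsilon\\ \rho(y,y'')\le\varepsilon\\ y'\ne y''}} \frac{W_p(\mu_{y'},\mu_{y''})}{\rho(y',y'')},$$ where $y',y''$ range over $Y$, and $$\mathcal{E}_p(f):=\sup_{y\in Y}|\nabla f(y)|_p .$$ Conventions: a quotient with $\rho(y',y'')=0$ and $W_p(\mu_{y'},\mu_{y''})>0$ equals $+\infty$; since all the quotients are $\ge 1$, the supremum is taken in $[1,+\infty]$ (so the supremum over an empty set of pairs is $1$). **$p$-metric measure foliation.** A metric foliation of $X$ is a partition $\mathcal{F}$ of $X$ into (nonempty) closed subsets, called leaves, such that $d(F,F')=d(x,F')$ for all $F,F'\in\mathcal{F}$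 and all $x\in F$. Its quotient space $X^*$ is the set of leaves, with the distance $d^*(F,F')=d(F,F')$, and the quotient map $X\to X^*$ sends a point to the leaf containing it. For $\mu\in\mathcal{M}_+(X)$, a metric foliation $\mathcal{F}$ is a $p$-metric measure foliation if the push-forward of $\mu$ under the quotient map is a locally finite Borel measure on $X^*$ and the conditional measures of the disintegration of $\mu$ along the leaves satisfy $W_p(\mu_F,\mu_{F'})=d^*(F,F')$ for all (not merely almost all) leaves $F,F'$. In the claim, the leaves are the fibers $\pi^{-1}(y)$, $X^*$ is identified as a set with $Y$ via $y\leftrightarrow\pi^{-1}(y)$, and the disintegration is the given family $\{\mu_y\}_{y\in Y}$; so the condition reads $W_p(\mu_{y'},\mu_{y''})=\rho(y',y'')$ for all $y',y''\in Y$. *)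

theory Defs
  imports "HOL-Probability.Probability"
begin

definition geodesic_space :: "'a::metric_space itself \<Rightarrow> bool" where
  "geodesic_space _ \<longleftrightarrow>
     (\<forall>x\<^sub>0 x\<^sub>1 :: 'a. \<exists>\<gamma> :: real \<Rightarrow> 'a. \<gamma> 0 = x\<^sub>0 \<and> \<gamma> 1 = x\<^sub>1 \<and>
        (\<forall>s\<in>{0..1}. \<forall>t\<in>{0..1}. dist (\<gamma> s) (\<gamma> t) = \<bar>s - t\<bar> * dist x\<^sub>0 x\<^sub>1))"

definition finite_radon_measure :: "'a::topological_space measure \<Rightarrow> bool" where
  "finite_radon_measure \<mu> \<longleftrightarrow>
     sets \<mu> = sets borel \<and> finite_measure \<mu> \<and>
     (\<forall>A\<in>sets borel. emeasure \<mu> A = (SUP K\<in>{K. K \<subseteq> A \<and> compact K}. emeasure \<mu> K))"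

definition support :: "'a::topological_space measure \<Rightarrow> 'a set" where
  "support m = {x. \<forall>U. open U \<longrightarrow> x \<in> U \<longrightarrow> emeasure m U > 0}"


subsection \<open>Wasserstein space\<close>

definition wasserstein_space :: "real \<Rightarrow> 'a::metric_space measure set" where
  "wasserstein_space p =
     {m. sets m = sets borel \<and> prob_space m \<and>
         (\<exists>x\<^sub>0. (\<integral>\<^sup>+x. ennreal (dist x x\<^sub>0 powr p) \<partial>m) < \<infinity>)}"

definition couplings :: "'a::metric_space measure \<Rightarrow> 'a measure \<Rightarrow> ('a \<times> 'a) measure set" where
  "couplings m m' =
     {\<gamma>. sets \<gamma> = sets borel \<and> prob_space \<gamma> \<and>
         distr \<gamma> borel fst = m \<and> distr \<gamma> borel snd = m'}"

text \<open>Real-valued: on the Wasserstein space the infimum below is finite, so nothing is lost by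
  the truncation of \<open>\<infinity>\<close> to \<open>0\<close> in \<^const>\<open>enn2real\<close>.\<close>

definition wasserstein_dist :: "real \<Rightarrow> 'a::metric_space measure \<Rightarrow> 'a measure \<Rightarrow> real" where
  "wasserstein_dist p m m' =
     enn2real (INF \<gamma>\<in>couplings m m'.
       \<integral>\<^sup>+z. ennreal (dist (fst z) (snd z) powr p) \<partial>\<gamma>) powr (1 / p)"


subsection \<open>Disintegrations and the energy of the disintegration map\<close>

text \<open>Borel dependence on \<open>y\<close> is measurability into the Giry \<open>\<sigma>\<close>-algebra of probability measures:
  \<open>y \<mapsto> f y A\<close> is Borel for every Borel set \<open>A\<close>.\<close>

definition disintegration ::
    "'a::metric_space measure \<Rightarrow> ('a \<Rightarrow> 'b::metric_space) \<Rightarrow> ('b \<Rightarrow> 'a measure) \<Rightarrow> bool" where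
  "disintegration \<mu> \<pi> f \<longleftrightarrow>
     (\<forall>y. sets (f y) = sets borel \<and> prob_space (f y)) \<and>
     (\<forall>y. emeasure (f y) (- (\<pi> -` {y})) = 0) \<and>
     f \<in> borel \<rightarrow>\<^sub>M prob_algebra borel \<and>
     (\<forall>A\<in>sets borel. emeasure \<mu> A = (\<integral>\<^sup>+y. emeasure (f y) A \<partial>(distr \<mu> borel \<pi>)))"

definition fiber_dist :: "('a::metric_space \<Rightarrow> 'b) \<Rightarrow> 'b \<Rightarrow> 'b \<Rightarrow> real" where
  "fiber_dist \<pi> y' y'' = setdist (\<pi> -` {y'}) (\<pi> -` {y''})"

text \<open>In \<^typ>\<open>ennreal\<close>, \<open>a / 0 = \<infinity>\<close> for \<open>a > 0\<close>. Inserting \<open>1\<close> takes the supremum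
  in \<open>[1, \<infinity>]\<close>, so that it is \<open>1\<close> when there are no admissible pairs.\<close>

definition disint_deriv ::
    "real \<Rightarrow> ('a::metric_space \<Rightarrow> 'b) \<Rightarrow> ('b \<Rightarrow> 'a measure) \<Rightarrow> 'b \<Rightarrow> ennreal" where
  "disint_deriv p \<pi> f y =
     Lim (at_right (0::real)) (\<lambda>\<epsilon>.
       Sup (insert 1
         {ennreal (wasserstein_dist p (f y') (f y'')) / ennreal (fiber_dist \<pi> y' y'') | y' y''.
            fiber_dist \<pi> y y' \<le> \<epsilon> \<and> fiber_dist \<pi> y y'' \<le> \<epsilon> \<and> y' \<noteq> y''}))"

definition disint_energy ::
    "real \<Rightarrow> ('a::metric_space \<Rightarrow> 'b) \<Rightarrow> ('b \<Rightarrow> 'a measure) \<Rightarrow> ennreal" where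
  "disint_energy p \<pi> f = (SUP y. disint_deriv p \<pi> f y)"


subsection \<open>Metric measure foliations\<close>

definition metric_foliation :: "'a::metric_space set set \<Rightarrow> bool" where
  "metric_foliation \<F> \<longleftrightarrow>
     partition_on UNIV \<F> \<and> (\<forall>F\<in>\<F>. closed F) \<and>
     (\<forall>F\<in>\<F>. \<forall>F'\<in>\<F>. \<forall>x\<in>F. setdist F F' = setdist {x} F')"

definition leaf_of :: "'a set set \<Rightarrow> 'a \<Rightarrow> 'a set" where
  "leaf_of \<F> x = (THE F. F \<in> \<F> \<and> x \<in> F)"

text \<open>For a metric foliation, \<^const>\<open>setdist\<close> is a metric on the set of leaves.\<close>

definition leaf_topology :: "'a::metric_space set set \<Rightarrow> 'a set topology" where
  "leaf_topology \<F> = Metric_space.mtopology \<F> setdist"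

definition leaf_borel :: "'a::metric_space set set \<Rightarrow> 'a set measure" where
  "leaf_borel \<F> = sigma \<F> {U. openin (leaf_topology \<F>) U}"

text \<open>The family \<open>\<kappa>\<close> gives, for each leaf, the conditional measure on that leaf; it is meant to
  be a given disintegration of \<open>\<mu>\<close> along the leaves. Measurability of the quotient map is what
  makes the push-forward in the third clause a Borel measure on the space of leaves.\<close>

definition metric_measure_foliation ::
    "real \<Rightarrow> 'a::metric_space measure \<Rightarrow> 'a set set \<Rightarrow> ('a set \<Rightarrow> 'a measure) \<Rightarrow> bool" where
  "metric_measure_foliation p \<mu> \<F> \<kappa> \<longleftrightarrow>
     metric_foliation \<F> \<and>
     leaf_of \<F> \<in> \<mu> \<rightarrow>\<^sub>M leaf_borel \<F> \<and>
     (\<forall>F\<in>\<F>. \<exists>U. openin (leaf_topology \<F>) U \<and> F \<in> U \<and>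
        emeasure (distr \<mu> (leaf_borel \<F>) (leaf_of \<F>)) U < \<infinity>) \<and>
     (\<forall>F\<in>\<F>. \<forall>F'\<in>\<F>. wasserstein_dist p (\<kappa> F) (\<kappa> F') = setdist F F')"

definition fibers :: "('a \<Rightarrow> 'b) \<Rightarrow> 'a set set" where
  "fibers \<pi> = range (\<lambda>y. \<pi> -` {y})"

text \<open>Transport of a family indexed by \<open>'b\<close> along the identification \<open>y \<leftrightarrow> \<pi> -` {y}\<close>, which is
  bijective onto the fibers when \<open>\<pi>\<close> is surjective.\<close>

definition on_fibers :: "('a \<Rightarrow> 'b) \<Rightarrow> ('b \<Rightarrow> 'c) \<Rightarrow> 'a set \<Rightarrow> 'c" where
  "on_fibers \<pi> f F = f (the_inv (\<lambda>y. \<pi> -` {y}) F)"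

end

theory Submission
  imports Defs
begin

text \<open>
  If the fibers form a \<open>p\<close>-metric measure foliation, distinct leaves are at positive distance and
  all the quotients that define the derivative equal \<open>1\<close>; so the energy is \<open>1\<close>. The content is in
  the converse.

  Any coupling of two conditional measures lives on the product of the two fibers, where
  the distance is at least the distance \<open>\<rho>\<close> of the fibers, so always \<open>\<rho> \<le> W\<^sub>p\<close>
  (lemma \<open>setdist_le_wasserstein_dist\<close>). For the opposite
  inequality, take points \<open>x', x''\<close> of the two fibers and a geodesic between them. Energy \<open>1\<close> means
  that near every fiber the disintegration map is \<open>(1 + \<delta>)\<close>-Lipschitz with respect to \<open>\<rho>\<close>, and the
  \<open>\<rho>\<close>-distance of the fibers through two points of the geodesic is at most the distance of these
  points. Hence \<open>t \<mapsto> \<mu>\<^sub>y\<close>, with \<open>y\<close> the image of the point at time \<open>t\<close>, is locally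
  \<open>(1 + \<delta>) d(x', x'')\<close>-Lipschitz; subdividing the unit interval and
  using the triangle inequality for \<open>W\<^sub>p\<close> makes this a global bound. Letting \<open>\<delta> \<rightarrow> 0\<close> and minimizing
  over \<open>x', x''\<close> gives \<open>W\<^sub>p \<le> \<rho>\<close> (lemma \<open>wasserstein_dist_le_fiber_dist\<close>).

  Finally \<open>W\<^sub>p = \<rho>\<close> forces the fibers to be equidistant
  (lemma \<open>equidistant_if_wasserstein_dist_le_setdist\<close>). If a point \<open>x\<close> of one
  fiber were further than \<open>\<rho>\<close> from the other, the same would hold with a margin on a small
  ball around \<open>x\<close>; this ball has positive mass because the fiber is the support of its conditional
  measure, so the cost of every coupling would exceed \<open>\<rho>\<^sup>p\<close> by a fixed amount. Equidistance makes the
  set of fibers a metric space for which the quotient map is \<open>1\<close>-Lipschitz, and the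
  conditions on the push-forward of \<open>\<mu>\<close> follow from continuity and finiteness.

  The triangle inequality for \<open>W\<^sub>p\<close> usually rests on gluing two couplings along their common marginal,
  which takes regular conditional probabilities. Since \<open>W\<^sub>p\<close> is an infimum, an approximate gluing is
  enough: cut the space into countably many Borel pieces of diameter less than \<open>\<eta>\<close> and make
  the two couplings conditionally independent given the piece that contains the middle point.
  The resulting measure has a density with respect to the product of the couplings
  (lemma \<open>glue_along_countable\<close>), and its two copies of the middle point are \<open>\<eta>\<close>-close.
\<close>

section \<open>Approximate gluing\<close>

lemma AE_nonnull_level:
  fixes s :: "'a \<Rightarrow> 'i::countable"
  assumes [measurable]: "s \<in> P \<rightarrow>\<^sub>M count_space UNIV"
  shows "AE x in P. emeasure P {x' \<in> space P. s x' = s x} \<noteq> 0"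
proof -
  have "AE x in P. s x = n \<longrightarrow> emeasure P {x' \<in> space P. s x' = n} \<noteq> 0" for n
  proof (cases "emeasure P {x' \<in> space P. s x' = n} = 0")
    case True
    have "AE x in P. \<not> (s x = n)"
      using True by (subst AE_iff_measurable[OF _ refl]) auto
    then show ?thesis by eventually_elim auto
  qed auto
  then have "AE x in P. \<forall>n. s x = n \<longrightarrow> emeasure P {x' \<in> space P. s x' = n} \<noteq> 0"
    unfolding AE_all_countable by blast
  then show ?thesis by eventually_elim auto
qed

text \<open>The measure \<open>R\<close> makes the two coordinates conditionally independent given the common value of \<open>s\<close>
  and \<open>t\<close>. With only countably many values, conditioning is restriction to a level set followed
  by division by its mass, so \<open>R\<close> has an explicit density with respect to the product.\<close>

lemma glue_along_countable:
  fixes s :: "'a \<Rightarrow> 'i::countable" and t :: "'b \<Rightarrow> 'i"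
  assumes "prob_space P" "prob_space Q"
    and s[measurable]: "s \<in> P \<rightarrow>\<^sub>M count_space UNIV"
    and t[measurable]: "t \<in> Q \<rightarrow>\<^sub>M count_space UNIV"
    and law: "\<And>n. emeasure P {x \<in> space P. s x = n} = emeasure Q {x \<in> space Q. t x = n}"
  obtains R where "sets R = sets (P \<Otimes>\<^sub>M Q)" "distr R P fst = P" "distr R Q snd = Q"
    "AE z in R. s (fst z) = t (snd z)"
proof -
  interpret P: prob_space P by fact
  interpret Q: prob_space Q by fact
  interpret PQ: pair_sigma_finite P Q ..
  define c where "c n = emeasure P {x \<in> space P. s x = n}" for n
  define g where "g z = (if s (fst z) = t (snd z) then inverse (c (s (fst z))) else 0)" for z
  have g[measurable]: "g \<in> borel_measurable (P \<Otimes>\<^sub>M Q)"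
    unfolding g_def by measurable
  have c_inv: "inverse (c n) * c n = 1" if "c n \<noteq> 0" for n
    using that P.emeasure_finite[of "{x \<in> space P. s x = n}"]
    by (metis c_def divide_ennreal_def ennreal_divide_self mult.commute top.not_eq_extremum P.emeasure_finite)
  \<comment> \<open>The factor \<open>inverse (c n)\<close> is chosen so that the density integrates to \<open>1\<close> over each
    slice; this is what leaves both marginals unchanged. The exceptional points form the union of
    the null level sets, a null set because there are only countably many.\<close>
  have int1: "AE x in P. (\<integral>\<^sup>+y. g (x, y) \<partial>Q) = 1"
    using AE_nonnull_level[OF s]
  proof eventually_elim
    fix x assume nz: "emeasure P {x' \<in> space P. s x' = s x} \<noteq> 0"
    have "(\<integral>\<^sup>+y. g (x, y) \<partial>Q)
        = (\<integral>\<^sup>+y. inverse (c (s x)) * indicator {y \<in> space Q. t y = s x} y \<partial>Q)"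
      by (intro nn_integral_cong) (auto simp: g_def indicator_def)
    also have "\<dots> = inverse (c (s x)) * c (s x)"
      by (subst nn_integral_cmult_indicator) (auto simp: c_def law)
    finally show "(\<integral>\<^sup>+y. g (x, y) \<partial>Q) = 1" using c_inv nz by (simp add: c_def)
  qed
  have int2: "AE y in Q. (\<integral>\<^sup>+x. g (x, y) \<partial>P) = 1"
    using AE_nonnull_level[OF t]
  proof eventually_elim
    fix y assume nz: "emeasure Q {y' \<in> space Q. t y' = t y} \<noteq> 0"
    have "(\<integral>\<^sup>+x. g (x, y) \<partial>P)
        = (\<integral>\<^sup>+x. inverse (c (t y)) * indicator {x \<in> space P. s x = t y} x \<partial>P)"
      by (intro nn_integral_cong) (auto simp: g_def indicator_def)
    also have "\<dots> = inverse (c (t y)) * c (t y)"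
      by (subst nn_integral_cmult_indicator) (auto simp: c_def)
    finally show "(\<integral>\<^sup>+x. g (x, y) \<partial>P) = 1" using c_inv nz by (simp add: c_def law)
  qed
  define R where "R = density (P \<Otimes>\<^sub>M Q) g"
  show thesis
  proof
    show "sets R = sets (P \<Otimes>\<^sub>M Q)" by (simp add: R_def)
    show "distr R P fst = P"
    proof (rule measure_eqI)
      fix A assume "A \<in> sets (distr R P fst)"
      then have A[measurable]: "A \<in> sets P" by simp
      have [measurable]: "fst \<in> R \<rightarrow>\<^sub>M P" by (simp add: R_def)
      have "emeasure (distr R P fst) A = (\<integral>\<^sup>+z. indicator A (fst z) \<partial>R)"
        by (simp flip: nn_integral_indicator add: nn_integral_distr)
      also have "\<dots> = (\<integral>\<^sup>+z. g z * indicator A (fst z) \<partial>(P \<Otimes>\<^sub>M Q))"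
        unfolding R_def by (subst nn_integral_density) auto
      also have "\<dots> = (\<integral>\<^sup>+x. \<integral>\<^sup>+y. g (x, y) * indicator A x \<partial>Q \<partial>P)"
        by (subst Q.nn_integral_fst[symmetric]) auto
      also have "\<dots> = (\<integral>\<^sup>+x. (\<integral>\<^sup>+y. g (x, y) \<partial>Q) * indicator A x \<partial>P)"
        by (intro nn_integral_cong nn_integral_multc) auto
      also have "\<dots> = (\<integral>\<^sup>+x. indicator A x \<partial>P)"
        by (rule nn_integral_cong_AE, use int1 in eventually_elim) auto
      finally show "emeasure (distr R P fst) A = emeasure P A" by simp
    qed simp
    show "distr R Q snd = Q"
    proof (rule measure_eqI)
      fix A assume "A \<in> sets (distr R Q snd)"
      then have A[measurable]: "A \<in> sets Q" by simp
      have [measurable]: "snd \<in> R \<rightarrow>\<^sub>M Q" by (simp add: R_def)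
      have "emeasure (distr R Q snd) A = (\<integral>\<^sup>+z. indicator A (snd z) \<partial>R)"
        by (simp flip: nn_integral_indicator add: nn_integral_distr)
      also have "\<dots> = (\<integral>\<^sup>+z. g z * indicator A (snd z) \<partial>(P \<Otimes>\<^sub>M Q))"
        unfolding R_def by (subst nn_integral_density) auto
      also have "\<dots> = (\<integral>\<^sup>+y. \<integral>\<^sup>+x. g (x, y) * indicator A y \<partial>P \<partial>Q)"
        by (subst PQ.nn_integral_snd[symmetric]) auto
      also have "\<dots> = (\<integral>\<^sup>+y. (\<integral>\<^sup>+x. g (x, y) \<partial>P) * indicator A y \<partial>Q)"
        by (intro nn_integral_cong nn_integral_multc) auto
      also have "\<dots> = (\<integral>\<^sup>+y. indicator A y \<partial>Q)"
        by (rule nn_integral_cong_AE, use int2 in eventually_elim) auto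
      finally show "emeasure (distr R Q snd) A = emeasure Q A" by simp
    qed simp
    show "AE z in R. s (fst z) = t (snd z)"
      unfolding R_def by (subst AE_density) (auto simp: g_def)
  qed
qed

lemma countable_mesh:
  fixes \<eta> :: real
  assumes "0 < \<eta>"
  obtains i :: "'a::{metric_space, second_countable_topology} \<Rightarrow> nat"
  where "i \<in> borel \<rightarrow>\<^sub>M count_space UNIV" "\<And>x y. i x = i y \<Longrightarrow> dist x y < \<eta>"
proof -
  obtain D :: "'a set" where D: "countable D" "\<And>U. open U \<Longrightarrow> U \<noteq> {} \<Longrightarrow> \<exists>d\<in>D. d \<in> U"
    by (rule countable_dense_setE) blast
  have "D \<noteq> {}" using D(2)[of UNIV] by auto
  define e where "e = from_nat_into D"
  have ex: "\<exists>n. dist x (e n) < \<eta> / 2" for x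
  proof -
    obtain d where "d \<in> D" "dist x d < \<eta> / 2"
      using D(2)[of "ball x (\<eta> / 2)"] assms by auto
    then show ?thesis
      using from_nat_into_surj[OF D(1)] by (metis e_def)
  qed
  define i where "i x = (LEAST n. dist x (e n) < \<eta> / 2)" for x
  have near: "dist x (e (i x)) < \<eta> / 2" for x
    unfolding i_def using LeastI_ex[OF ex] .
  show thesis
  proof
    show "i \<in> borel \<rightarrow>\<^sub>M count_space UNIV"
      unfolding i_def by measurable
    show "dist x y < \<eta>" if "i x = i y" for x y
      using near[of x] near[of y] that dist_triangle2[of x y "e (i x)"] by simp
  qed
qed

section \<open>Minkowski's inequality\<close>

text \<open>Convexity of \<open>x powr p\<close> at the point \<open>l (a / l) + (1 - l) (b / (1 - l))\<close>.\<close>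

lemma powr_add_le_weighted:
  fixes a b l p :: real
  assumes "0 \<le> a" "0 \<le> b" "0 < l" "l < 1" "1 \<le> p"
  shows "(a + b) powr p \<le> l powr (1 - p) * a powr p + (1 - l) powr (1 - p) * b powr p"
proof -
  have ge1: "1 \<le> k powr (1 - p)" if "0 < k" "k < 1" for k :: real
    using that assms powr_mono'[of "1 - p" 0 k] by simp
  show ?thesis
  proof (cases "a = 0 \<or> b = 0")
    \<comment> \<open>If a summand vanishes, its argument leaves the open half-line on which convexity is applied.\<close>
    case True
    then show ?thesis
      using ge1[of l] ge1[of "1 - l"] assms
        mult_right_mono[of 1 "l powr (1 - p)" "a powr p"]
        mult_right_mono[of 1 "(1 - l) powr (1 - p)" "b powr p"]
      by auto
  next
    case False
    have sc: "k * (c / k) powr p = k powr (1 - p) * c powr p" if "0 < k" "0 < c" for k c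
      using that by (simp add: powr_divide powr_diff)
    have "(a + b) powr p = (l * (a / l) + (1 - l) * (b / (1 - l))) powr p"
      using assms by simp
    also have "\<dots> \<le> l * (a / l) powr p + (1 - l) * (b / (1 - l)) powr p"
      using convex_onD[OF powr_convex[OF assms(5)], of "1 - l" "a / l" "b / (1 - l)"] False assms
      by simp
    finally show ?thesis using sc[of l a] sc[of "1 - l" b] False assms by simp
  qed
qed

text \<open>This is Minkowski's inequality with the norms replaced by arbitrary positive upper bounds
  \<open>A\<close> and \<open>B\<close>. Integrate the weighted inequality with \<open>l = A / (A + B)\<close>, the weight
  that makes its right-hand side collapse to \<open>(A + B) powr p\<close>; positivity of the bounds keeps
  this weight strictly between \<open>0\<close> and \<open>1\<close>.\<close>

lemma nn_integral_powr_add_le: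
  fixes u v :: "'a \<Rightarrow> real"
  assumes [measurable]: "u \<in> borel_measurable M" "v \<in> borel_measurable M"
    and nn: "\<And>x. 0 \<le> u x" "\<And>x. 0 \<le> v x" and p: "1 \<le> p"
    and A: "0 < A" "(\<integral>\<^sup>+x. ennreal (u x powr p) \<partial>M) \<le> ennreal (A powr p)"
    and B: "0 < B" "(\<integral>\<^sup>+x. ennreal (v x powr p) \<partial>M) \<le> ennreal (B powr p)"
  shows "(\<integral>\<^sup>+x. ennreal ((u x + v x) powr p) \<partial>M) \<le> ennreal ((A + B) powr p)"
proof -
  define l where "l = A / (A + B)"
  have l: "0 < l" "l < 1" and l': "1 - l = B / (A + B)"
    using A(1) B(1) by (auto simp: l_def field_simps)
  have sc: "(k / (A + B)) powr (1 - p) * k powr p = (A + B) powr (p - 1) * k" if "0 < k" for k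
    using that A(1) B(1) by (simp add: powr_divide powr_diff)
  have "(\<integral>\<^sup>+x. ennreal ((u x + v x) powr p) \<partial>M)
    \<le> (\<integral>\<^sup>+x. ennreal (l powr (1 - p)) * ennreal (u x powr p)
          + ennreal ((1 - l) powr (1 - p)) * ennreal (v x powr p) \<partial>M)"
    using powr_add_le_weighted[OF nn l p]
    by (intro nn_integral_mono) (simp add: ennreal_mult[symmetric] ennreal_plus[symmetric] del: ennreal_plus)
  also have "\<dots> = ennreal (l powr (1 - p)) * (\<integral>\<^sup>+x. ennreal (u x powr p) \<partial>M)
      + ennreal ((1 - l) powr (1 - p)) * (\<integral>\<^sup>+x. ennreal (v x powr p) \<partial>M)"
    by (simp add: nn_integral_add nn_integral_cmult)
  also have "\<dots> \<le> ennreal (l powr (1 - p)) * ennreal (A powr p)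
      + ennreal ((1 - l) powr (1 - p)) * ennreal (B powr p)"
    using A B by (intro add_mono mult_left_mono) auto
  also have "\<dots> = ennreal (l powr (1 - p) * A powr p + (1 - l) powr (1 - p) * B powr p)"
    by (simp add: ennreal_mult ennreal_plus)
  also have "l powr (1 - p) * A powr p + (1 - l) powr (1 - p) * B powr p
      = (A + B) powr (p - 1) * (A + B)"
    unfolding l' unfolding l_def using sc A(1) B(1) by (simp add: algebra_simps)
  also have "\<dots> = (A + B) powr p"
    using A(1) B(1) by (simp add: powr_diff)
  finally show ?thesis .
qed

section \<open>The Wasserstein distance\<close>

lemma closed_support: "closed (support m)"
proof -
  have "- support m = \<Union>{U. open U \<and> emeasure m U = 0}"
    by (auto simp: support_def not_gr_zero)
  moreover have "open (\<Union>{U. open U \<and> emeasure m U = 0})"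
    by (intro open_Union) auto
  ultimately show ?thesis by (simp add: closed_def)
qed

definition transport_cost :: "real \<Rightarrow> ('a::metric_space \<times> 'a) measure \<Rightarrow> ennreal" where
  "transport_cost p \<gamma> = (\<integral>\<^sup>+z. ennreal (dist (fst z) (snd z) powr p) \<partial>\<gamma>)"

lemma wasserstein_spaceD:
  assumes "m \<in> wasserstein_space p"
  shows "sets m = sets borel" "prob_space m" "space m = UNIV"
  using assms sets_eq_imp_space_eq[of m borel] by (auto simp: wasserstein_space_def)

lemma couplingsD:
  assumes "\<gamma> \<in> couplings m m'"
  shows "sets \<gamma> = sets borel" "prob_space \<gamma>" "distr \<gamma> borel fst = m" "distr \<gamma> borel snd = m'"
  using assms by (auto simp: couplings_def)

lemma measurable_coupling:
  fixes m m' :: "'a::{metric_space, second_countable_topology} measure"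
  assumes "\<gamma> \<in> couplings m m'"
  shows "fst \<in> \<gamma> \<rightarrow>\<^sub>M borel" "snd \<in> \<gamma> \<rightarrow>\<^sub>M borel"
proof -
  have "fst \<in> (borel :: ('a \<times> 'a) measure) \<rightarrow>\<^sub>M borel" "snd \<in> (borel :: ('a \<times> 'a) measure) \<rightarrow>\<^sub>M borel"
    unfolding borel_prod[symmetric] by simp_all
  then show "fst \<in> \<gamma> \<rightarrow>\<^sub>M borel" "snd \<in> \<gamma> \<rightarrow>\<^sub>M borel"
    using measurable_cong_sets[OF couplingsD(1)[OF assms] refl] by blast+
qed

lemma coupling_AE:
  fixes m m' :: "'a::{metric_space, second_countable_topology} measure"
  assumes "\<gamma> \<in> couplings m m'" "AE x in m. x \<in> F" "AE x in m'. x \<in> F'"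
  shows "AE z in \<gamma>. fst z \<in> F \<and> snd z \<in> F'"
proof -
  have "AE z in \<gamma>. fst z \<in> F"
    using AE_distrD[OF measurable_coupling(1)[OF assms(1)]] assms by (auto simp: couplings_def)
  moreover have "AE z in \<gamma>. snd z \<in> F'"
    using AE_distrD[OF measurable_coupling(2)[OF assms(1)]] assms by (auto simp: couplings_def)
  ultimately show ?thesis by eventually_elim auto
qed

lemma wasserstein_dist_le:
  assumes "\<gamma> \<in> couplings m m'" "transport_cost p \<gamma> \<le> ennreal (A powr p)" "0 \<le> A" "1 \<le> p"
  shows "wasserstein_dist p m m' \<le> A"
proof -
  have "enn2real (INF \<gamma>\<in>couplings m m'. transport_cost p \<gamma>) \<le> A powr p"
    by (rule enn2real_leI) (use assms in \<open>auto intro: INF_lower2\<close>)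
  then have "wasserstein_dist p m m' \<le> (A powr p) powr (1 / p)"
    unfolding wasserstein_dist_def transport_cost_def[symmetric]
    using assms by (intro powr_mono2) auto
  then show ?thesis using assms by (simp add: powr_powr)
qed

lemma ex_powr_bound:
  assumes "I < (\<infinity>::ennreal)" "1 \<le> (p::real)"
  obtains A where "0 < A" "I \<le> ennreal (A powr p)"
proof
  show "0 < (enn2real I + 1) powr (1 / p)"
    using enn2real_nonneg[of I] by (simp add: add_nonneg_eq_0_iff)
  show "I \<le> ennreal (((enn2real I + 1) powr (1 / p)) powr p)"
    using assms enn2real_nonneg[of I]
    by (cases I) (auto simp: powr_powr simp del: enn2real_nonneg intro!: ennreal_leI)
qed

text \<open>The product coupling has finite cost, by Minkowski's inequality along the route from \<open>x\<close> through
  the two base points to \<open>y\<close>. Hence the infimum in \<^const>\<open>wasserstein_dist\<close> is finite on the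
  Wasserstein space, and the truncation of \<open>\<infinity>\<close> there does no harm.\<close>

lemma ex_finite_coupling:
  fixes m m' :: "'a::{metric_space, second_countable_topology} measure"
  assumes m: "m \<in> wasserstein_space p" and m': "m' \<in> wasserstein_space p" and p: "1 \<le> p"
  obtains \<gamma> where "\<gamma> \<in> couplings m m'" "transport_cost p \<gamma> < \<infinity>"
proof -
  interpret m: prob_space m using m by (rule wasserstein_spaceD)
  interpret m': prob_space m' using m' by (rule wasserstein_spaceD)
  interpret P: pair_prob_space m m' ..
  have sets[measurable_cong, simp]: "sets m = sets borel" "sets m' = sets borel"
    using m m' by (auto dest: wasserstein_spaceD)
  obtain x0 where x0: "(\<integral>\<^sup>+x. ennreal (dist x x0 powr p) \<partial>m) < \<infinity>"
    using m by (auto simp: wasserstein_space_def)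
  obtain y0 where y0: "(\<integral>\<^sup>+x. ennreal (dist x y0 powr p) \<partial>m') < \<infinity>"
    using m' by (auto simp: wasserstein_space_def)
  obtain A where A: "0 < A" "(\<integral>\<^sup>+x. ennreal (dist x x0 powr p) \<partial>m) \<le> ennreal (A powr p)"
    by (rule ex_powr_bound[OF x0 p])
  obtain B where B: "0 < B" "(\<integral>\<^sup>+x. ennreal (dist x y0 powr p) \<partial>m') \<le> ennreal (B powr p)"
    by (rule ex_powr_bound[OF y0 p])
  \<comment> \<open>The summand \<open>1\<close> makes \<open>C\<close> positive when the base points coincide.\<close>
  define C where "C = dist x0 y0 + 1"
  have C: "0 < C" by (simp add: C_def add_nonneg_pos)
  define \<gamma> where "\<gamma> = m \<Otimes>\<^sub>M m'"
  have sets_\<gamma>[measurable_cong]: "sets \<gamma> = sets (borel \<Otimes>\<^sub>M borel)"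
    unfolding \<gamma>_def by (rule sets_pair_measure_cong) auto
  have fst: "distr \<gamma> borel fst = m"
    using m'.distr_pair_fst[of m] distr_cong[OF refl, of borel m \<gamma> fst fst] by (simp add: \<gamma>_def)
  have snd: "distr \<gamma> borel snd = m'"
  proof (rule measure_eqI)
    fix S assume "S \<in> sets (distr \<gamma> borel snd)"
    then have S[measurable]: "S \<in> sets borel" by simp
    have "emeasure (distr \<gamma> borel snd) S = emeasure \<gamma> (space m \<times> S)"
      using sets_eq_imp_space_eq[OF sets(1)]
      by (subst emeasure_distr) (auto simp: \<gamma>_def space_pair_measure sets_eq_imp_space_eq[OF sets(2)]
          intro!: arg_cong2[where f=emeasure])
    also have "\<dots> = emeasure m' S"
      unfolding \<gamma>_def by (subst m'.emeasure_pair_measure_Times) (use m.emeasure_space_1 in \<open>auto simp: wasserstein_spaceD(3)[OF m]\<close>)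
    finally show "emeasure (distr \<gamma> borel snd) S = emeasure m' S" .
  qed simp
  have "\<gamma> \<in> couplings m m'"
    unfolding couplings_def mem_Collect_eq
    using fst snd P.prob_space_axioms sets_\<gamma> unfolding borel_prod \<gamma>_def by blast
  moreover
  have "(\<integral>\<^sup>+z. ennreal ((dist (fst z) x0 + (dist (snd z) y0 + C)) powr p) \<partial>\<gamma>)
      \<le> ennreal ((A + (B + C)) powr p)"
  proof (intro nn_integral_powr_add_le)
    show "(\<integral>\<^sup>+z. ennreal (dist (fst z) x0 powr p) \<partial>\<gamma>) \<le> ennreal (A powr p)"
      using A(2) by (subst (asm) fst[symmetric], subst (asm) nn_integral_distr) auto
    show "(\<integral>\<^sup>+z. ennreal (dist (snd z) y0 powr p) \<partial>\<gamma>) \<le> ennreal (B powr p)"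
      using B(2) by (subst (asm) snd[symmetric], subst (asm) nn_integral_distr) auto
    show "(\<integral>\<^sup>+z. ennreal (C powr p) \<partial>\<gamma>) \<le> ennreal (C powr p)"
      by (simp add: \<gamma>_def P.emeasure_space_1)
  qed (use A B C p in auto)
  moreover have "transport_cost p \<gamma>
      \<le> (\<integral>\<^sup>+z. ennreal ((dist (fst z) x0 + (dist (snd z) y0 + C)) powr p) \<partial>\<gamma>)"
    unfolding transport_cost_def
  proof (intro nn_integral_mono ennreal_leI powr_mono2)
    fix z :: "'a \<times> 'a"
    show "dist (fst z) (snd z) \<le> dist (fst z) x0 + (dist (snd z) y0 + C)"
      using dist_triangle[of "fst z" "snd z" x0] dist_triangle[of x0 "snd z" y0]
      by (simp add: C_def dist_commute)
  qed (use p in auto)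
  ultimately have "transport_cost p \<gamma> \<le> ennreal ((A + (B + C)) powr p)"
    by (simp only: order_trans)
  also have "\<dots> < \<infinity>" by simp
  finally show thesis using that \<open>\<gamma> \<in> couplings m m'\<close> by blast
qed

lemma wasserstein_dist_lessE:
  fixes m m' :: "'a::{metric_space, second_countable_topology} measure"
  assumes "m \<in> wasserstein_space p" "m' \<in> wasserstein_space p" "1 \<le> p"
    and less: "wasserstein_dist p m m' < A"
  obtains \<gamma> where "\<gamma> \<in> couplings m m'" "transport_cost p \<gamma> \<le> ennreal (A powr p)"
proof -
  define I where "I = (INF \<gamma>\<in>couplings m m'. transport_cost p \<gamma>)"
  obtain \<gamma>' where "\<gamma>' \<in> couplings m m'" "transport_cost p \<gamma>' < \<infinity>"
    by (rule ex_finite_coupling[OF assms(1-3)])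
  then have I_fin: "I < \<infinity>"
    unfolding I_def by (meson INF_lower order_le_less_trans)
  have W: "wasserstein_dist p m m' = enn2real I powr (1 / p)"
    by (simp add: wasserstein_dist_def I_def transport_cost_def)
  then have "0 \<le> wasserstein_dist p m m'" by simp
  have "enn2real I = wasserstein_dist p m m' powr p"
    using assms(3) unfolding W by (simp add: powr_powr)
  also have "\<dots> < A powr p"
    using less \<open>0 \<le> _\<close> assms(3) by (intro powr_less_mono2) auto
  finally have "I < ennreal (A powr p)"
    using I_fin by (metis enn2real_nonneg ennreal_enn2real ennreal_lessI infinity_ennreal_def
        order_le_less_trans)
  then show thesis
    unfolding I_def INF_less_iff using that by (auto intro: less_imp_le)
qed

lemma wasserstein_dist_nonneg: "0 \<le> wasserstein_dist p m m'"
  by (simp add: wasserstein_dist_def)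

lemma wasserstein_dist_self:
  fixes m :: "'a::{metric_space, second_countable_topology} measure"
  assumes "m \<in> wasserstein_space p" "1 \<le> p"
  shows "wasserstein_dist p m m = 0"
proof -
  interpret prob_space m using assms(1) by (rule wasserstein_spaceD)
  have [measurable_cong, simp]: "sets m = sets borel"
    using assms by (auto dest: wasserstein_spaceD)
  have [measurable]: "(\<lambda>x. (x, x)) \<in> m \<rightarrow>\<^sub>M borel" "fst \<in> (borel :: ('a \<times> 'a) measure) \<rightarrow>\<^sub>M borel"
    "snd \<in> (borel :: ('a \<times> 'a) measure) \<rightarrow>\<^sub>M borel"
    unfolding borel_prod[symmetric] by simp_all
  have "distr m borel (\<lambda>x. (x, x)) \<in> couplings m m"
    by (auto simp: couplings_def distr_distr comp_def prob_space_distr distr_id2)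
  moreover have "transport_cost p (distr m borel (\<lambda>x. (x, x))) \<le> ennreal (0 powr p)"
    unfolding transport_cost_def by (subst nn_integral_distr) auto
  ultimately have "wasserstein_dist p m m \<le> 0"
    using assms(2) by (intro wasserstein_dist_le) auto
  then show ?thesis using wasserstein_dist_nonneg[of p m m] by simp
qed

text \<open>The gluing runs along the index of the piece, in a countable partition of mesh \<open>\<eta>\<close>, that
  contains the middle point; the two laws of this index agree because both couplings have \<open>m2\<close>
  as a marginal.\<close>

lemma glue_couplings:
  fixes m1 m2 m3 :: "'a::{metric_space, second_countable_topology} measure"
  assumes \<gamma>: "\<gamma> \<in> couplings m1 m2" and \<gamma>': "\<gamma>' \<in> couplings m2 m3" and "0 < \<eta>"
  obtains R :: "(('a \<times> 'a) \<times> ('a \<times> 'a)) measure"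
  where "sets R = sets (borel \<Otimes>\<^sub>M borel)" "distr R borel fst = \<gamma>" "distr R borel snd = \<gamma>'"
    "AE z in R. dist (snd (fst z)) (fst (snd z)) \<le> \<eta>"
proof -
  obtain i :: "'a \<Rightarrow> nat" where i[measurable]: "i \<in> borel \<rightarrow>\<^sub>M count_space UNIV"
    and near: "\<And>x y. i x = i y \<Longrightarrow> dist x y < \<eta>"
    using countable_mesh[OF \<open>0 < \<eta>\<close>] by blast
  note [measurable] = measurable_coupling[OF \<gamma>] measurable_coupling[OF \<gamma>']
  have sets[simp]: "sets \<gamma> = sets borel" "sets \<gamma>' = sets borel"
    using \<gamma> \<gamma>' by (auto dest: couplingsD)
  have law: "emeasure \<gamma> {z \<in> space \<gamma>. i (snd z) = n} = emeasure \<gamma>' {z \<in> space \<gamma>'. i (fst z) = n}" for n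
  proof -
    have "{x. i x = n} \<in> sets borel"
      using measurable_sets[OF i, of "{n}"] by (simp add: vimage_def)
    then have "emeasure m2 {x. i x = n} = emeasure \<gamma> {z \<in> space \<gamma>. i (snd z) = n}"
      "emeasure m2 {x. i x = n} = emeasure \<gamma>' {z \<in> space \<gamma>'. i (fst z) = n}"
      by (subst couplingsD(4)[OF \<gamma>, symmetric] couplingsD(3)[OF \<gamma>', symmetric],
          subst emeasure_distr, auto intro!: arg_cong2[where f=emeasure])+
    then show ?thesis by simp
  qed
  obtain R where R: "sets R = sets (\<gamma> \<Otimes>\<^sub>M \<gamma>')" "distr R \<gamma> fst = \<gamma>" "distr R \<gamma>' snd = \<gamma>'"
    "AE z in R. i (snd (fst z)) = i (fst (snd z))"
    using glue_along_countable[OF couplingsD(2)[OF \<gamma>] couplingsD(2)[OF \<gamma>'],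
        of "\<lambda>z. i (snd z)" "\<lambda>z. i (fst z)"] law by auto
  show thesis
  proof
    show "sets R = sets (borel \<Otimes>\<^sub>M borel)"
      unfolding R(1) by (rule sets_pair_measure_cong) auto
    show "distr R borel fst = \<gamma>" "distr R borel snd = \<gamma>'"
      using R(2,3) distr_cong[OF refl, of borel \<gamma> R fst fst] distr_cong[OF refl, of borel \<gamma>' R snd snd]
      by auto
    show "AE z in R. dist (snd (fst z)) (fst (snd z)) \<le> \<eta>"
      using R(4) by eventually_elim (auto dest: near intro: less_imp_le)
  qed
qed

text \<open>Take the outer coordinates of the glued measure; the distance between them is at most the sum of
  the two transport distances and the gap \<open>\<eta>\<close> between the copies of the middle point.\<close>

lemma compose_couplings:
  fixes m1 m2 m3 :: "'a::{metric_space, second_countable_topology} measure"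
  assumes \<gamma>: "\<gamma> \<in> couplings m1 m2" "transport_cost p \<gamma> \<le> ennreal (A powr p)" "0 < A"
    and \<gamma>': "\<gamma>' \<in> couplings m2 m3" "transport_cost p \<gamma>' \<le> ennreal (B powr p)" "0 < B"
    and "0 < \<eta>" "1 \<le> p"
  obtains \<gamma>'' where "\<gamma>'' \<in> couplings m1 m3" "transport_cost p \<gamma>'' \<le> ennreal ((A + (B + \<eta>)) powr p)"
proof -
  obtain R :: "(('a \<times> 'a) \<times> ('a \<times> 'a)) measure" where
    R: "sets R = sets (borel \<Otimes>\<^sub>M borel)" "distr R borel fst = \<gamma>" "distr R borel snd = \<gamma>'"
      "AE z in R. dist (snd (fst z)) (fst (snd z)) \<le> \<eta>"
    by (rule glue_couplings[OF \<gamma>(1) \<gamma>'(1) \<open>0 < \<eta>\<close>])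
  note [measurable_cong] = R(1)
  have [measurable]: "fst \<in> (borel :: ('a \<times> 'a) measure) \<rightarrow>\<^sub>M borel"
    "snd \<in> (borel :: ('a \<times> 'a) measure) \<rightarrow>\<^sub>M borel"
    unfolding borel_prod[symmetric] by simp_all
  have [measurable]: "(\<lambda>z. dist (fst z) (snd z)) \<in> borel_measurable (borel :: ('a \<times> 'a) measure)"
    by (intro borel_measurable_continuous_onI continuous_intros)
  have [measurable]: "fst \<in> R \<rightarrow>\<^sub>M borel" "snd \<in> R \<rightarrow>\<^sub>M borel" by simp_all
  have pair[measurable]: "(\<lambda>z. (fst (fst z), snd (snd z))) \<in> R \<rightarrow>\<^sub>M borel"
    unfolding borel_prod[symmetric] by measurable
  interpret R: prob_space R
    using couplingsD(2)[OF \<gamma>(1)] R(2) by (metis \<open>fst \<in> R \<rightarrow>\<^sub>M borel\<close> prob_space_distrD)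
  define \<gamma>'' where "\<gamma>'' = distr R borel (\<lambda>z. (fst (fst z), snd (snd z)))"
  have "distr \<gamma>'' borel fst = distr (distr R borel fst) borel fst"
    "distr \<gamma>'' borel snd = distr (distr R borel snd) borel snd"
    unfolding \<gamma>''_def by (subst (1 2) distr_distr; simp add: comp_def)+
  then have "\<gamma>'' \<in> couplings m1 m3"
    using R couplingsD[OF \<gamma>(1)] couplingsD[OF \<gamma>'(1)]
    by (auto simp: couplings_def \<gamma>''_def intro!: R.prob_space_distr)
  moreover
  have "(\<integral>\<^sup>+z. ennreal ((dist (fst (fst z)) (snd (fst z)) + (dist (fst (snd z)) (snd (snd z)) + \<eta>)) powr p) \<partial>R)
      \<le> ennreal ((A + (B + \<eta>)) powr p)"
  proof (intro nn_integral_powr_add_le)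
    show "(\<integral>\<^sup>+z. ennreal (dist (fst (fst z)) (snd (fst z)) powr p) \<partial>R) \<le> ennreal (A powr p)"
      using \<gamma>(2) unfolding transport_cost_def R(2)[symmetric] by (subst (asm) nn_integral_distr) auto
    show "(\<integral>\<^sup>+z. ennreal (dist (fst (snd z)) (snd (snd z)) powr p) \<partial>R) \<le> ennreal (B powr p)"
      using \<gamma>'(2) unfolding transport_cost_def R(3)[symmetric] by (subst (asm) nn_integral_distr) auto
    show "(\<integral>\<^sup>+z. ennreal (\<eta> powr p) \<partial>R) \<le> ennreal (\<eta> powr p)"
      by (simp add: R.emeasure_space_1)
  qed (use assms in auto)
  moreover have "transport_cost p \<gamma>'' \<le>
    (\<integral>\<^sup>+z. ennreal ((dist (fst (fst z)) (snd (fst z)) + (dist (fst (snd z)) (snd (snd z)) + \<eta>)) powr p) \<partial>R)"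
  proof -
    have "transport_cost p \<gamma>'' = (\<integral>\<^sup>+z. ennreal (dist (fst (fst z)) (snd (snd z)) powr p) \<partial>R)"
      unfolding transport_cost_def \<gamma>''_def by (subst nn_integral_distr) auto
    also have "\<dots> \<le>
      (\<integral>\<^sup>+z. ennreal ((dist (fst (fst z)) (snd (fst z)) + (dist (fst (snd z)) (snd (snd z)) + \<eta>)) powr p) \<partial>R)"
      using R(4)
    proof (intro nn_integral_mono_AE, eventually_elim)
      fix z :: "('a \<times> 'a) \<times> ('a \<times> 'a)" assume "dist (snd (fst z)) (fst (snd z)) \<le> \<eta>"
      then have "dist (fst (fst z)) (snd (snd z))
          \<le> dist (fst (fst z)) (snd (fst z)) + (dist (fst (snd z)) (snd (snd z)) + \<eta>)"
        using dist_triangle[of "fst (fst z)" "snd (snd z)" "snd (fst z)"]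
          dist_triangle[of "snd (fst z)" "snd (snd z)" "fst (snd z)"] by linarith
      then show "ennreal (dist (fst (fst z)) (snd (snd z)) powr p)
          \<le> ennreal ((dist (fst (fst z)) (snd (fst z)) + (dist (fst (snd z)) (snd (snd z)) + \<eta>)) powr p)"
        using \<open>1 \<le> p\<close> by (intro ennreal_leI powr_mono2) auto
    qed
    finally show ?thesis .
  qed
  ultimately show thesis by (intro that) (auto intro: order_trans)
qed

lemma wasserstein_dist_triangle:
  fixes m1 m2 m3 :: "'a::{metric_space, second_countable_topology} measure"
  assumes m: "m1 \<in> wasserstein_space p" "m2 \<in> wasserstein_space p" "m3 \<in> wasserstein_space p"
    and p: "1 \<le> p"
  shows "wasserstein_dist p m1 m3 \<le> wasserstein_dist p m1 m2 + wasserstein_dist p m2 m3"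
proof (rule field_le_epsilon)
  fix e :: real assume e: "0 < e"
  define A where "A = wasserstein_dist p m1 m2 + e / 3"
  define B where "B = wasserstein_dist p m2 m3 + e / 3"
  have A: "wasserstein_dist p m1 m2 < A" "0 < A" and B: "wasserstein_dist p m2 m3 < B" "0 < B"
    using e wasserstein_dist_nonneg[of p m1 m2] wasserstein_dist_nonneg[of p m2 m3]
    by (auto simp: A_def B_def intro: add_nonneg_pos)
  obtain \<gamma> where \<gamma>: "\<gamma> \<in> couplings m1 m2" "transport_cost p \<gamma> \<le> ennreal (A powr p)"
    by (rule wasserstein_dist_lessE[OF m(1,2) p A(1)])
  obtain \<gamma>' where \<gamma>': "\<gamma>' \<in> couplings m2 m3" "transport_cost p \<gamma>' \<le> ennreal (B powr p)"
    by (rule wasserstein_dist_lessE[OF m(2,3) p B(1)])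
  obtain \<gamma>'' where "\<gamma>'' \<in> couplings m1 m3"
    "transport_cost p \<gamma>'' \<le> ennreal ((A + (B + e / 3)) powr p)"
    using compose_couplings[OF \<gamma> A(2) \<gamma>' B(2) _ p, of "e / 3"] e by auto
  then have "wasserstein_dist p m1 m3 \<le> A + (B + e / 3)"
    using A B e p by (intro wasserstein_dist_le) auto
  then show "wasserstein_dist p m1 m3 \<le> wasserstein_dist p m1 m2 + wasserstein_dist p m2 m3 + e"
    by (simp add: A_def B_def)
qed

lemma setdist_le_wasserstein_dist:
  fixes m m' :: "'a::{metric_space, second_countable_topology} measure"
  assumes "m \<in> wasserstein_space p" "m' \<in> wasserstein_space p" "1 \<le> p"
    and conc: "AE x in m. x \<in> F" "AE x in m'. x \<in> F'"
  shows "setdist F F' \<le> wasserstein_dist p m m'"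
proof (rule field_le_epsilon)
  fix e :: real assume e: "0 < e"
  define A where "A = wasserstein_dist p m m' + e"
  have A: "wasserstein_dist p m m' < A" "0 < A"
    using e wasserstein_dist_nonneg[of p m m'] by (auto simp: A_def intro: add_nonneg_pos)
  obtain \<gamma> where \<gamma>: "\<gamma> \<in> couplings m m'" "transport_cost p \<gamma> \<le> ennreal (A powr p)"
    by (rule wasserstein_dist_lessE[OF assms(1-3) A(1)])
  interpret prob_space \<gamma> using \<gamma>(1) by (rule couplingsD)
  have "ennreal (setdist F F' powr p) = (\<integral>\<^sup>+z. ennreal (setdist F F' powr p) \<partial>\<gamma>)"
    by (simp add: emeasure_space_1)
  also have "\<dots> \<le> transport_cost p \<gamma>"
    unfolding transport_cost_def
    using coupling_AE[OF \<gamma>(1) conc]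
  proof (intro nn_integral_mono_AE, eventually_elim)
    fix z assume "fst z \<in> F \<and> snd z \<in> F'"
    then show "ennreal (setdist F F' powr p) \<le> ennreal (dist (fst z) (snd z) powr p)"
      using assms(3) by (intro ennreal_leI powr_mono2 setdist_le_dist) auto
  qed
  finally have "setdist F F' powr p \<le> A powr p"
    using \<gamma>(2) by (metis ennreal_le_iff order_trans powr_ge_zero)
  then show "setdist F F' \<le> wasserstein_dist p m m' + e"
    using A assms(3) powr_less_mono2[of p A "setdist F F'"] by (fastforce simp: A_def)
qed

text \<open>If \<open>x\<close> had distance \<open>r + 2 \<delta>\<close> from \<open>F'\<close>, where \<open>r = setdist F F'\<close>, then all of \<open>ball x \<delta>\<close> would
  have distance at least \<open>r + \<delta>\<close> from \<open>F'\<close>. The ball has positive mass \<open>b\<close>, so every coupling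
  costs at least \<open>r powr p + c * b\<close>, where \<open>c\<close> is the excess of \<open>(r + \<delta>) powr p\<close>
  over \<open>r powr p\<close>. This bound is uniform in the coupling, so no optimal coupling is involved.\<close>

lemma equidistant_if_wasserstein_dist_le_setdist:
  fixes m m' :: "'a::{metric_space, second_countable_topology} measure"
  assumes m: "m \<in> wasserstein_space p" "m' \<in> wasserstein_space p" "1 \<le> p"
    and conc: "AE x in m. x \<in> F" "AE x in m'. x \<in> F'"
    and W: "wasserstein_dist p m m' \<le> setdist F F'"
    and x: "x \<in> F" "x \<in> support m"
  shows "setdist {x} F' = setdist F F'"
proof (rule ccontr)
  define r where "r = setdist F F'"
  define \<delta> where "\<delta> = (setdist {x} F' - r) / 2"
  assume "setdist {x} F' \<noteq> setdist F F'"
  then have \<delta>: "0 < \<delta>"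
    using setdist_le_sing[OF x(1), of F'] by (auto simp: \<delta>_def r_def)
  have r: "0 \<le> r" by (simp add: r_def)
  define c where "c = (r + \<delta>) powr p - r powr p"
  have c: "0 < c"
    using powr_less_mono2[of p r "r + \<delta>"] r \<delta> m(3) by (simp add: c_def)
  interpret m: prob_space m using m(1) by (rule wasserstein_spaceD)
  define b where "b = measure m (ball x \<delta>)"
  have b: "0 < b"
  proof -
    have "0 < emeasure m (ball x \<delta>)"
      using x(2) \<delta> unfolding support_def by (metis (mono_tags) centre_in_ball mem_Collect_eq open_ball)
    then show ?thesis by (simp add: b_def m.emeasure_eq_measure)
  qed
  \<comment> \<open>\<open>A\<close> lies strictly between \<open>r\<close> and the \<open>p\<close>-th root of the lower bound for the cost.\<close>
  define A where "A = (r powr p + c * b / 2) powr (1 / p)"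
  have Ap: "A powr p = r powr p + c * b / 2"
    using m(3) b c by (simp add: A_def powr_powr)
  have "r < A"
  proof (rule ccontr)
    assume "\<not> r < A"
    then have "A powr p \<le> r powr p"
      using m(3) by (intro powr_mono2) (auto simp: A_def)
    then show False using Ap b c mult_pos_pos[OF c b] by simp
  qed
  then have "wasserstein_dist p m m' < A" using W by (simp add: r_def)
  then obtain \<gamma> where \<gamma>: "\<gamma> \<in> couplings m m'" "transport_cost p \<gamma> \<le> ennreal (A powr p)"
    by (rule wasserstein_dist_lessE[OF m])
  interpret prob_space \<gamma> using \<gamma>(1) by (rule couplingsD)
  have ind: "(\<lambda>z. indicator (ball x \<delta>) (fst z) :: ennreal) \<in> borel_measurable \<gamma>"
    by (rule measurable_compose[OF measurable_coupling(1)[OF \<gamma>(1)] borel_measurable_indicator]) simp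
  have "ennreal (r powr p + c * b)
      = (\<integral>\<^sup>+z. ennreal (r powr p) \<partial>\<gamma>) + ennreal c * (\<integral>\<^sup>+z. indicator (ball x \<delta>) z \<partial>m)"
    using b c by (simp add: emeasure_space_1 b_def m.emeasure_eq_measure ennreal_mult wasserstein_spaceD(1)[OF m(1)])
  also have "(\<integral>\<^sup>+z. indicator (ball x \<delta>) z \<partial>m) = (\<integral>\<^sup>+z. indicator (ball x \<delta>) (fst z) \<partial>\<gamma>)"
    unfolding couplingsD(3)[OF \<gamma>(1), symmetric]
    by (rule nn_integral_distr) (simp_all add: measurable_coupling[OF \<gamma>(1)] borel_measurable_indicator)
  also have "(\<integral>\<^sup>+z. ennreal (r powr p) \<partial>\<gamma>) + ennreal c * (\<integral>\<^sup>+z. indicator (ball x \<delta>) (fst z) \<partial>\<gamma>)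
      = (\<integral>\<^sup>+z. ennreal (r powr p) + ennreal c * indicator (ball x \<delta>) (fst z) \<partial>\<gamma>)"
    by (subst nn_integral_add) (use ind in \<open>auto simp: nn_integral_cmult\<close>)
  also have "\<dots> \<le> transport_cost p \<gamma>"
    unfolding transport_cost_def using coupling_AE[OF \<gamma>(1) conc]
  proof (intro nn_integral_mono_AE, eventually_elim)
    fix z assume z: "fst z \<in> F \<and> snd z \<in> F'"
    show "ennreal (r powr p) + ennreal c * indicator (ball x \<delta>) (fst z)
        \<le> ennreal (dist (fst z) (snd z) powr p)"
    proof (cases "fst z \<in> ball x \<delta>")
      case True
      have "r + 2 * \<delta> \<le> dist x (snd z)"
        using setdist_le_dist[of x "{x}" "snd z" F'] z by (simp add: \<delta>_def field_simps)
      then have "r + \<delta> \<le> dist (fst z) (snd z)"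
        using True dist_triangle[of x "snd z" "fst z"] by simp
      then have "(r + \<delta>) powr p \<le> dist (fst z) (snd z) powr p"
        using r \<delta> m(3) by (intro powr_mono2) auto
      then show ?thesis
        using True c by (simp add: c_def ennreal_plus[symmetric] del: ennreal_plus)
    next
      case False
      then show ?thesis
        using z m(3) r by (auto intro!: ennreal_leI powr_mono2 setdist_le_dist simp: r_def)
    qed
  qed
  finally have "r powr p + c * b \<le> A powr p"
    using \<gamma>(2) by (metis ennreal_le_iff order_trans powr_ge_zero)
  then show False
    using Ap mult_pos_pos[OF c b] by linarith
qed


section \<open>Energy and Lipschitz bounds\<close>

lemma Lim_at_right_mono:
  fixes h :: "real \<Rightarrow> ennreal"
  assumes mono: "\<And>a b. 0 < a \<Longrightarrow> a \<le> b \<Longrightarrow> h a \<le> h b"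
  shows "Lim (at_right 0) h = (INF e\<in>{0<..}. h e)"
proof (rule tendsto_Lim)
  show "(h \<longlongrightarrow> (INF e\<in>{0<..}. h e)) (at_right 0)"
  proof (rule order_tendstoI)
    fix a assume "a < (INF e\<in>{0<..}. h e)"
    then show "\<forall>\<^sub>F e in at_right 0. a < h e"
      by (auto simp: eventually_at_filter intro!: always_eventually dest: less_INF_D)
  next
    fix a assume "(INF e\<in>{0<..}. h e) < a"
    then obtain e where e: "0 < e" "h e < a" by (auto simp: INF_less_iff)
    then show "\<forall>\<^sub>F e in at_right 0. h e < a"
      using mono[of _ e] by (intro eventually_at_rightI[of 0 e]) (auto intro: order_le_less_trans[OF _ e(2)])
  qed
qed simp

text \<open>The supremum grows with \<open>\<epsilon>\<close>, so the limit exists and is an infimum.\<close>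

lemma disint_deriv_eq_INF:
  "disint_deriv p \<pi> f y =
     (INF \<epsilon>\<in>{0<..}. Sup (insert 1
         {ennreal (wasserstein_dist p (f y') (f y'')) / ennreal (fiber_dist \<pi> y' y'') | y' y''.
            fiber_dist \<pi> y y' \<le> \<epsilon> \<and> fiber_dist \<pi> y y'' \<le> \<epsilon> \<and> y' \<noteq> y''}))"
  unfolding disint_deriv_def
  by (rule Lim_at_right_mono, intro Sup_subset_mono insert_mono Collect_mono)
    (blast intro: order_trans)

lemma le_mult_if_ennreal_divide_le:
  fixes a b c :: real
  assumes "ennreal a / ennreal b \<le> ennreal c" "0 \<le> b" "0 \<le> c"
  shows "a \<le> c * b"
proof (cases "b = 0 \<or> a \<le> 0")
  case True
  then show ?thesis
    using assms by (cases "a \<le> 0") (auto simp: ennreal_divide_eq_top_iff top_unique divide_ennreal_def ennreal_mult_eq_top_iff intro: order_trans)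
next
  case False
  then have "a / b \<le> c" using assms by (simp add: divide_ennreal)
  then show ?thesis using False assms by (simp add: field_simps)
qed

text \<open>The quotients with \<open>\<rho>(y', y'') = 0\<close> are covered as well: being finite, they must have
  numerator \<open>0\<close>.\<close>

lemma local_lipschitz_if_energy_le_1:
  assumes "disint_energy p \<pi> f \<le> 1" "0 < \<delta>"
  obtains \<epsilon> where "0 < \<epsilon>"
    "\<And>y' y''. fiber_dist \<pi> y y' \<le> \<epsilon> \<Longrightarrow> fiber_dist \<pi> y y'' \<le> \<epsilon> \<Longrightarrow> y' \<noteq> y'' \<Longrightarrow>
        wasserstein_dist p (f y') (f y'') \<le> (1 + \<delta>) * fiber_dist \<pi> y' y''"
proof -
  have "disint_deriv p \<pi> f y \<le> 1"
    using assms(1) by (auto simp: disint_energy_def SUP_le_iff)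
  also have "1 < ennreal (1 + \<delta>)"
    using assms(2) by (simp add: ennreal_less_iff flip: ennreal_1)
  finally obtain \<epsilon> where \<epsilon>: "0 < \<epsilon>" and less: "Sup (insert 1
         {ennreal (wasserstein_dist p (f y') (f y'')) / ennreal (fiber_dist \<pi> y' y'') | y' y''.
            fiber_dist \<pi> y y' \<le> \<epsilon> \<and> fiber_dist \<pi> y y'' \<le> \<epsilon> \<and> y' \<noteq> y''}) < ennreal (1 + \<delta>)"
    unfolding disint_deriv_eq_INF INF_less_iff by auto
  show thesis
  proof
    fix y' y'' assume y: "fiber_dist \<pi> y y' \<le> \<epsilon>" "fiber_dist \<pi> y y'' \<le> \<epsilon>" "y' \<noteq> y''"
    have "ennreal (wasserstein_dist p (f y') (f y'')) / ennreal (fiber_dist \<pi> y' y'')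
      \<le> Sup (insert 1
         {ennreal (wasserstein_dist p (f y') (f y'')) / ennreal (fiber_dist \<pi> y' y'') | y' y''.
            fiber_dist \<pi> y y' \<le> \<epsilon> \<and> fiber_dist \<pi> y y'' \<le> \<epsilon> \<and> y' \<noteq> y''})"
      using y by (intro Sup_upper) auto
    then show "wasserstein_dist p (f y') (f y'') \<le> (1 + \<delta>) * fiber_dist \<pi> y' y''"
      using less assms(2)
      by (intro le_mult_if_ennreal_divide_le) (auto simp: fiber_dist_def)
  qed fact
qed

text \<open>By Bolzano's bisection principle, as the bound \<open>C * (b - a)\<close> is additive over
  adjacent intervals while \<^const>\<open>wasserstein_dist\<close> is subadditive.\<close>

lemma wasserstein_dist_path_le:
  fixes g :: "real \<Rightarrow> 'a::{metric_space, second_countable_topology} measure"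
  assumes g: "\<And>t. g t \<in> wasserstein_space p" and p: "1 \<le> p"
    and loc: "\<And>t. 0 \<le> t \<Longrightarrow> t \<le> 1 \<Longrightarrow> \<exists>d>0. \<forall>a b. 0 \<le> a \<and> a \<le> t \<and> t \<le> b \<and> b \<le> 1 \<and> b - a < d \<longrightarrow>
        wasserstein_dist p (g a) (g b) \<le> C * (b - a)"
  shows "wasserstein_dist p (g 0) (g 1) \<le> C"
proof -
  define P where "P a b \<longleftrightarrow> (0 \<le> a \<longrightarrow> b \<le> 1 \<longrightarrow> wasserstein_dist p (g a) (g b) \<le> C * (b - a))" for a b
  have "P 0 1"
  proof (rule Bolzano)
    fix a b c assume "P a b" "P b c" "a \<le> b" "b \<le> c"
    then show "P a c"
      using wasserstein_dist_triangle[OF g g g p, of a c b] by (auto simp: P_def algebra_simps)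
  next
    fix t :: real assume "0 \<le> t" "t \<le> 1"
    then obtain d where "d > 0" "\<forall>a b. 0 \<le> a \<and> a \<le> t \<and> t \<le> b \<and> b \<le> 1 \<and> b - a < d \<longrightarrow>
        wasserstein_dist p (g a) (g b) \<le> C * (b - a)" using loc by blast
    then show "\<exists>d>0. \<forall>a b. a \<le> t \<and> t \<le> b \<and> b - a < d \<longrightarrow> P a b"
      by (auto simp: P_def)
  qed simp
  then show ?thesis by (simp add: P_def)
qed

lemma fiber_dist_le_dist: "fiber_dist \<pi> (\<pi> x) (\<pi> x') \<le> dist x x'"
  unfolding fiber_dist_def by (rule setdist_le_dist) auto

text \<open>Apply \<open>wasserstein_dist_path_le\<close> to the conditional measures of the fibers through the points of a
  geodesic \<open>\<gamma>\<close>. The fiber distance along \<open>\<gamma>\<close> is at most \<open>\<bar>s - t\<bar> * L\<close>, with \<open>L\<close> the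
  length of \<open>\<gamma>\<close>: this keeps the fibers met shortly before and after time \<open>t\<close> within the range
  of the local Lipschitz estimate, and turns that estimate into one in the time parameter.
  The path of fibers may stay on one fiber for a while, where the quotients give no
  information but the Wasserstein distance is \<open>0\<close>.\<close>

lemma wasserstein_dist_le_fiber_dist:
  fixes \<pi> :: "'a::{metric_space, second_countable_topology} \<Rightarrow> 'b"
  assumes p: "1 \<le> p" and geo: "geodesic_space TYPE('a)" and f: "\<And>y. f y \<in> wasserstein_space p"
    and surj: "surj \<pi>" and energy: "disint_energy p \<pi> f \<le> 1"
  shows "wasserstein_dist p (f y') (f y'') \<le> fiber_dist \<pi> y' y''"
proof -
  have step: "wasserstein_dist p (f (\<pi> x')) (f (\<pi> x'')) \<le> (1 + \<delta>) * dist x' x''" if \<delta>: "0 < \<delta>" for \<delta> x' x''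
  proof -
    define L where "L = dist x' x''"
    obtain \<gamma> :: "real \<Rightarrow> 'a" where \<gamma>: "\<gamma> 0 = x'" "\<gamma> 1 = x''"
      "\<And>s t. s \<in> {0..1} \<Longrightarrow> t \<in> {0..1} \<Longrightarrow> dist (\<gamma> s) (\<gamma> t) = \<bar>s - t\<bar> * L"
      using geo unfolding geodesic_space_def L_def by blast
    have "wasserstein_dist p (f (\<pi> (\<gamma> 0))) (f (\<pi> (\<gamma> 1))) \<le> (1 + \<delta>) * L"
    proof (rule wasserstein_dist_path_le[of "\<lambda>t. f (\<pi> (\<gamma> t))", OF f p])
      fix t :: real assume t: "0 \<le> t" "t \<le> 1"
      obtain \<epsilon> where \<epsilon>: "0 < \<epsilon>"
        "\<And>y' y''. fiber_dist \<pi> (\<pi> (\<gamma> t)) y' \<le> \<epsilon> \<Longrightarrow> fiber_dist \<pi> (\<pi> (\<gamma> t)) y'' \<le> \<epsilon> \<Longrightarrow> y' \<noteq> y'' \<Longrightarrow>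
            wasserstein_dist p (f y') (f y'') \<le> (1 + \<delta>) * fiber_dist \<pi> y' y''"
        using local_lipschitz_if_energy_le_1[OF energy \<delta>] by blast
      have L: "0 \<le> L" by (simp add: L_def)
      show "\<exists>d>0. \<forall>a b. 0 \<le> a \<and> a \<le> t \<and> t \<le> b \<and> b \<le> 1 \<and> b - a < d \<longrightarrow>
          wasserstein_dist p (f (\<pi> (\<gamma> a))) (f (\<pi> (\<gamma> b))) \<le> (1 + \<delta>) * L * (b - a)"
      proof (intro exI conjI allI impI; (elim conjE)?)
        \<comment> \<open>\<open>L + 1\<close> in place of \<open>L\<close>, which is \<open>0\<close> for a constant geodesic.\<close>
        show "0 < \<epsilon> / (L + 1)" using \<epsilon>(1) L by simp
        fix a b assume ab: "0 \<le> a" "a \<le> t" "t \<le> b" "b \<le> 1" "b - a < \<epsilon> / (L + 1)"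
        have small: "fiber_dist \<pi> (\<pi> (\<gamma> t)) (\<pi> (\<gamma> s)) \<le> \<epsilon>" if "s \<in> {a..b}" for s
        proof -
          have "\<bar>t - s\<bar> * L \<le> (b - a) * (L + 1)"
            using that ab t L by (intro mult_mono) auto
          also have "\<dots> \<le> \<epsilon>" using ab(5) L by (simp add: field_simps)
          finally show ?thesis
            using fiber_dist_le_dist[of \<pi> "\<gamma> t" "\<gamma> s"] \<gamma>(3)[of t s] that ab t by auto
        qed
        show "wasserstein_dist p (f (\<pi> (\<gamma> a))) (f (\<pi> (\<gamma> b))) \<le> (1 + \<delta>) * L * (b - a)"
        proof (cases "\<pi> (\<gamma> a) = \<pi> (\<gamma> b)")
          case True
          then show ?thesis using wasserstein_dist_self[OF f p] L ab \<delta> by simp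
        next
          case False
          have "wasserstein_dist p (f (\<pi> (\<gamma> a))) (f (\<pi> (\<gamma> b)))
              \<le> (1 + \<delta>) * fiber_dist \<pi> (\<pi> (\<gamma> a)) (\<pi> (\<gamma> b))"
            using False ab by (intro \<epsilon>(2) small) auto
          also have "\<dots> \<le> (1 + \<delta>) * (\<bar>a - b\<bar> * L)"
            using fiber_dist_le_dist[of \<pi> "\<gamma> a" "\<gamma> b"] \<gamma>(3)[of a b] \<delta> ab
            by (intro mult_left_mono) auto
          finally show ?thesis using ab by (simp add: ac_simps)
        qed
      qed
    qed
    then show ?thesis by (simp add: \<gamma> L_def)
  qed
  have le_dist: "wasserstein_dist p (f (\<pi> x')) (f (\<pi> x'')) \<le> dist x' x''" for x' x''
  proof (rule field_le_epsilon)
    fix e :: real assume e: "0 < e"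
    define D where "D = dist x' x''"
    have D: "0 \<le> D" by (simp add: D_def)
    have "wasserstein_dist p (f (\<pi> x')) (f (\<pi> x'')) \<le> (1 + e / (D + 1)) * D"
    proof -
      have "0 < e / (D + 1)" using e D by simp
      then show ?thesis unfolding D_def by (rule step)
    qed
    also have "\<dots> = D + e * (D / (D + 1))" by (simp add: algebra_simps)
    also have "\<dots> \<le> D + e * 1"
      using e D by (intro add_left_mono mult_left_mono) auto
    finally show "wasserstein_dist p (f (\<pi> x')) (f (\<pi> x'')) \<le> dist x' x'' + e"
      by (simp add: D_def)
  qed
  show ?thesis
    unfolding fiber_dist_def
  proof (rule le_setdistI)
    show "\<pi> -` {y'} \<noteq> {}" "\<pi> -` {y''} \<noteq> {}"
      using surjD[OF surj, of y'] surjD[OF surj, of y''] by auto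
    fix x' x'' assume "x' \<in> \<pi> -` {y'}" "x'' \<in> \<pi> -` {y''}"
    then show "wasserstein_dist p (f y') (f y'') \<le> dist x' x''"
      using le_dist[of x' x''] by simp
  qed
qed

section \<open>Metric foliations\<close>

text \<open>
  By equidistance, distances to the middle leaf can be measured from one and the same
  point of it, which gives the triangle inequality; a leaf at distance \<open>0\<close> from a closed
  leaf meets it.
\<close>

lemma Metric_space_metric_foliation:
  assumes "metric_foliation \<F>"
  shows "Metric_space \<F> setdist"
proof
  have part: "partition_on UNIV \<F>" and closed: "\<And>F. F \<in> \<F> \<Longrightarrow> closed F"
    and equi: "\<And>F G x. F \<in> \<F> \<Longrightarrow> G \<in> \<F> \<Longrightarrow> x \<in> F \<Longrightarrow> setdist F G = setdist {x} G"
    using assms unfolding metric_foliation_def by blast+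
  have nonempty: "F \<noteq> {}" if "F \<in> \<F>" for F
    using part that by (auto simp: partition_on_def)
  show "0 \<le> setdist F G" for F G :: "'a set" by simp
  show "setdist F G = setdist G F" for F G :: "'a set" by (rule setdist_sym)
  show "setdist F G = 0 \<longleftrightarrow> F = G" if FG: "F \<in> \<F>" "G \<in> \<F>" for F G
  proof
    assume 0: "setdist F G = 0"
    obtain x where x: "x \<in> F" using nonempty[OF FG(1)] by blast
    have "setdist {x} G = 0" using equi[OF FG x] 0 by simp
    then have "x \<in> G" using setdist_eq_0_sing_1 closed nonempty FG(2) by (metis closure_closed)
    then show "F = G" using partition_onD2[OF part] FG x by (auto dest: disjointD)
  qed (simp add: setdist_refl)
  show "setdist F H \<le> setdist F G + setdist G H" if FGH: "F \<in> \<F>" "G \<in> \<F>" "H \<in> \<F>" for F G H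
  proof -
    obtain a where a: "a \<in> G" using nonempty[OF FGH(2)] by blast
    have "setdist G F = setdist {a} F" "setdist G H = setdist {a} H"
      using equi[OF FGH(2) _ a] FGH by simp_all
    then show ?thesis
      using setdist_triangle[of F H a] by (simp add: setdist_sym)
  qed
qed

lemma leaf_of:
  assumes "partition_on UNIV \<F>"
  shows "leaf_of \<F> x \<in> \<F>" "x \<in> leaf_of \<F> x"
proof -
  have "\<exists>!F. F \<in> \<F> \<and> x \<in> F"
    using assms by (auto simp: partition_on_def disjoint_def)
  from theI'[OF this] show "leaf_of \<F> x \<in> \<F>" "x \<in> leaf_of \<F> x"
    by (simp_all add: leaf_of_def)
qed

text \<open>The quotient map is \<open>1\<close>-Lipschitz, since points are at least as far apart as their leaves.\<close>

lemma open_vimage_leaf_of: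
  assumes fol: "metric_foliation \<F>" and U: "openin (leaf_topology \<F>) U"
  shows "open (leaf_of \<F> -` U)"
proof -
  interpret Metric_space \<F> setdist by (rule Metric_space_metric_foliation[OF fol])
  have part: "partition_on UNIV \<F>" using fol by (simp add: metric_foliation_def)
  show ?thesis
    unfolding open_dist
  proof (intro ballI)
    fix x assume "x \<in> leaf_of \<F> -` U"
    then obtain r where r: "r > 0" "mball (leaf_of \<F> x) r \<subseteq> U"
      using U by (auto simp: leaf_topology_def openin_mtopology)
    have "z \<in> leaf_of \<F> -` U" if "dist z x < r" for z
    proof -
      have "setdist (leaf_of \<F> x) (leaf_of \<F> z) \<le> dist x z"
        by (intro setdist_le_dist leaf_of part)
      then have "leaf_of \<F> z \<in> mball (leaf_of \<F> x) r"
        using that leaf_of[OF part] by (auto simp: dist_commute)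
      then show ?thesis using r by auto
    qed
    then show "\<exists>e>0. \<forall>z. dist z x < e \<longrightarrow> z \<in> leaf_of \<F> -` U" using r by auto
  qed
qed

lemma measurable_leaf_of:
  assumes fol: "metric_foliation \<F>" and sets: "sets \<mu> = sets borel"
  shows "leaf_of \<F> \<in> \<mu> \<rightarrow>\<^sub>M leaf_borel \<F>"
  unfolding leaf_borel_def
proof (rule measurable_measure_of)
  interpret Metric_space \<F> setdist by (rule Metric_space_metric_foliation[OF fol])
  show "{U. openin (leaf_topology \<F>) U} \<subseteq> Pow \<F>"
    by (auto simp: leaf_topology_def openin_mtopology)
  show "leaf_of \<F> \<in> space \<mu> \<rightarrow> \<F>"
    using fol by (auto simp: metric_foliation_def intro: leaf_of)
  show "leaf_of \<F> -` U \<inter> space \<mu> \<in> sets \<mu>" if "U \<in> {U. openin (leaf_topology \<F>) U}" for U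
    using open_vimage_leaf_of[OF fol] that sets_eq_imp_space_eq[OF sets] by (simp add: sets)
qed

lemma on_fibers_vimage:
  assumes "surj \<pi>"
  shows "on_fibers \<pi> f (\<pi> -` {y}) = f y"
proof -
  have "inj (\<lambda>y. \<pi> -` {y})"
    using assms by (intro injI) (metis surjE vimage_singleton_eq)
  then show ?thesis by (simp add: on_fibers_def the_inv_f_f[where f="\<lambda>y. \<pi> -` {y}"])
qed

lemma metric_foliation_fibersI:
  assumes "surj \<pi>" "\<And>y. closed (\<pi> -` {y})"
    and "\<And>y y' x. \<pi> x = y \<Longrightarrow> setdist {x} (\<pi> -` {y'}) = setdist (\<pi> -` {y}) (\<pi> -` {y'})"
  shows "metric_foliation (fibers \<pi>)"
  unfolding metric_foliation_def
proof (intro conjI)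
  have "\<pi> -` {y} \<noteq> {}" for y using surjD[OF assms(1), of y] by auto
  then show "partition_on UNIV (fibers \<pi>)"
    by (auto simp: partition_on_def disjoint_def fibers_def)
qed (use assms in \<open>auto simp: fibers_def\<close>)

lemma disint_energy_eq_1I:
  assumes "\<And>y' y''. y' \<noteq> y'' \<Longrightarrow> 0 < fiber_dist \<pi> y' y'' \<and> wasserstein_dist p (f y') (f y'') = fiber_dist \<pi> y' y''"
  shows "disint_energy p \<pi> f = 1"
proof -
  have "disint_deriv p \<pi> f y = 1" for y
  proof -
    have "Sup (insert 1
         {ennreal (wasserstein_dist p (f y') (f y'')) / ennreal (fiber_dist \<pi> y' y'') | y' y''.
            fiber_dist \<pi> y y' \<le> \<epsilon> \<and> fiber_dist \<pi> y y'' \<le> \<epsilon> \<and> y' \<noteq> y''}) = 1" for \<epsilon>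
    proof (rule cSup_eq_maximum)
      fix q assume "q \<in> insert 1
         {ennreal (wasserstein_dist p (f y') (f y'')) / ennreal (fiber_dist \<pi> y' y'') | y' y''.
            fiber_dist \<pi> y y' \<le> \<epsilon> \<and> fiber_dist \<pi> y y'' \<le> \<epsilon> \<and> y' \<noteq> y''}"
      then show "q \<le> 1"
        using assms by (auto simp: divide_ennreal less_imp_neq[symmetric])
    qed simp
    then show ?thesis by (simp add: disint_deriv_eq_INF)
  qed
  then show ?thesis by (simp add: disint_energy_def)
qed

section \<open>Energy one characterizes metric measure foliations\<close>

theorem theorem1p1:
  fixes p :: real
    and \<mu> :: "'a::polish_space measure"
    and \<pi> :: "'a \<Rightarrow> 'b::polish_space"
    and f :: "'b \<Rightarrow> 'a measure"
  assumes "1 \<le> p"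
    and "geodesic_space TYPE('a)"
    and "locally_compact_space (euclidean :: 'a topology)"
    and "locally_compact_space (euclidean :: 'b topology)"
    and "finite_radon_measure \<mu>"
    and "\<pi> \<in> borel_measurable borel"
    and "disintegration \<mu> \<pi> f"
    and "\<And>y. f y \<in> wasserstein_space p"
    and "\<And>y. support (f y) = \<pi> -` {y}"
  shows "disint_energy p \<pi> f = 1 \<longleftrightarrow>
         metric_measure_foliation p \<mu> (fibers \<pi>) (on_fibers \<pi> f)"
proof -
  note p = assms(1) and f = assms(8) and supp = assms(9)
  have closed: "closed (\<pi> -` {y})" for y
    using closed_support[of "f y"] supp by simp
  have null: "emeasure (f y) (- (\<pi> -` {y})) = 0" for y
    using assms(7) by (simp add: disintegration_def)
  have conc: "AE x in f y. x \<in> \<pi> -` {y}" for y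
    by (rule AE_I[OF _ null])
      (use closed[of y] in \<open>auto simp: wasserstein_spaceD[OF f] borel_closed\<close>)
  \<comment> \<open>An empty fiber could not carry a probability measure.\<close>
  have surj: "surj \<pi>"
    unfolding surj_def
  proof
    fix y
    interpret prob_space "f y" using f by (rule wasserstein_spaceD)
    have "\<pi> -` {y} \<noteq> {}"
      using null[of y] emeasure_space_1 by (auto simp: wasserstein_spaceD[OF f])
    then show "\<exists>x. y = \<pi> x" by auto
  qed
  show ?thesis
  proof
    assume energy: "disint_energy p \<pi> f = 1"
    have W: "wasserstein_dist p (f y') (f y'') = fiber_dist \<pi> y' y''" for y' y''
      using wasserstein_dist_le_fiber_dist[where f=f, OF p assms(2) f surj] energy
        setdist_le_wasserstein_dist[OF f f p conc conc]
      by (intro antisym) (auto simp: fiber_dist_def)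
    have fol: "metric_foliation (fibers \<pi>)"
    proof (rule metric_foliation_fibersI[OF surj closed])
      fix y y' x assume "\<pi> x = y"
      then show "setdist {x} (\<pi> -` {y'}) = setdist (\<pi> -` {y}) (\<pi> -` {y'})"
        using W[of y y'] supp[of y]
        by (intro equidistant_if_wasserstein_dist_le_setdist[OF f f p conc conc])
          (auto simp: fiber_dist_def)
    qed
    interpret Metric_space "fibers \<pi>" setdist by (rule Metric_space_metric_foliation[OF fol])
    have meas: "leaf_of (fibers \<pi>) \<in> \<mu> \<rightarrow>\<^sub>M leaf_borel (fibers \<pi>)"
      using assms(5) by (intro measurable_leaf_of[OF fol]) (simp add: finite_radon_measure_def)
    interpret \<mu>: finite_measure \<mu> using assms(5) by (simp add: finite_radon_measure_def)
    interpret D: finite_measure "distr \<mu> (leaf_borel (fibers \<pi>)) (leaf_of (fibers \<pi>))"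
      by (rule \<mu>.finite_measure_distr[OF meas])
    \<comment> \<open>The push-forward is finite, so the whole space of leaves is a neighbourhood of finite mass.\<close>
    have "\<exists>U. openin (leaf_topology (fibers \<pi>)) U \<and> F \<in> U \<and>
        emeasure (distr \<mu> (leaf_borel (fibers \<pi>)) (leaf_of (fibers \<pi>))) U < \<infinity>"
      if "F \<in> fibers \<pi>" for F
    proof (intro exI conjI)
      show "openin (leaf_topology (fibers \<pi>)) (fibers \<pi>)"
        using openin_topspace[of mtopology] by (simp add: leaf_topology_def)
      show "emeasure (distr \<mu> (leaf_borel (fibers \<pi>)) (leaf_of (fibers \<pi>))) (fibers \<pi>) < \<infinity>"
        using D.emeasure_finite[of "fibers \<pi>"] by (simp only: infinity_ennreal_def less_top)
    qed fact
    then show "metric_measure_foliation p \<mu> (fibers \<pi>) (on_fibers \<pi> f)"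
      using fol meas W by (auto simp: metric_measure_foliation_def fibers_def on_fibers_vimage[OF surj] fiber_dist_def)
  next
    assume mmf: "metric_measure_foliation p \<mu> (fibers \<pi>) (on_fibers \<pi> f)"
    then interpret Metric_space "fibers \<pi>" setdist
      by (intro Metric_space_metric_foliation) (simp add: metric_measure_foliation_def)
    show "disint_energy p \<pi> f = 1"
    proof (rule disint_energy_eq_1I)
      fix y' y'' :: 'b assume ne: "y' \<noteq> y''"
      have fib: "\<pi> -` {y'} \<in> fibers \<pi>" "\<pi> -` {y''} \<in> fibers \<pi>" by (auto simp: fibers_def)
      have "\<pi> -` {y'} \<noteq> \<pi> -` {y''}"
        using ne surj by (metis surjE vimage_singleton_eq)
      then have "0 < fiber_dist \<pi> y' y''"
        using zero[OF fib] setdist_pos_le[of "\<pi> -` {y'}" "\<pi> -` {y''}"] unfolding fiber_dist_def by linarith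
      moreover have "wasserstein_dist p (f y') (f y'') = fiber_dist \<pi> y' y''"
        using mmf fib unfolding metric_measure_foliation_def fiber_dist_def
        by (metis on_fibers_vimage[OF surj])
      ultimately show "0 < fiber_dist \<pi> y' y'' \<and> wasserstein_dist p (f y') (f y'') = fiber_dist \<pi> y' y''"
        by simp
    qed
  qed
qed

end
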